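(* Let $\upsilon\ge1$ be an integer, $q>-1$ and $p$ real, $s\ge0$ an integer with $s<\frac{p-1}{2}$, let $t,y$ be real numbers, $w>b$ real, and let $\tau\in\mathbb C$ with $\operatorname{Re}(\tau)>0$. Then $${}_w\mathbb I_{b^+}^{\tau}\left((w-b)^q\;{}_KN_{s;\upsilon}^{(p,q)}\big(t,(w-b)y\big)\right)=(w-b)^{q+\tau}\;{}_KN_{s;\upsilon}^{(p,q+\tau)}\big(t,(w-b)y\big).$$
   Context: $(a)_n$ is the Pochhammer symbol. The first set of finite bivariate biorthogonal N-Konhauser polynomials is $${}_KN_{s;\upsilon}^{(p,q)}(t,w)=\Gamma(p-s)\sum_{k=0}^{s}\sum_{m=0}^{s-k}\frac{(-s)_{k+m}\,t^{s-k}w^{\upsilon m}}{\Gamma(p-2s+k)\,\Gamma(q+1+\upsilon m)\,k!\,m!},$$ the same formula being used when the second parameter is complex. The Riemann–Liouville fractional integral is ${}_w\mathbb I_{b^+}^{\kappa}(f)(w)=\frac1{\Gamma(\kappa)}\int_b^w(w-\xi)^{\kappa-1}f(\xi)\,d\xi$ for $\operatorname{Re}(\kappa)>0$, $w>b$. *)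

theory Defs
  imports "HOL-Analysis.Analysis"
begin

text \<open>Polymorphic over the class of \<^const>\<open>Gamma\<close>, so that the same formula serves for real and for
  complex parameters. At a pole of the Gamma function the library value is 0, and division
  by 0 gives 0, in agreement with the convention that \<open>1 / \<Gamma>\<close> vanishes there.\<close>

definition konhauser_N :: "nat \<Rightarrow> nat \<Rightarrow> 'a::Gamma \<Rightarrow> 'a \<Rightarrow> 'a \<Rightarrow> 'a \<Rightarrow> 'a" where
  "konhauser_N s \<upsilon> p q t w =
     Gamma (p - of_nat s) *
     (\<Sum>k=0..s. \<Sum>m=0..s-k.
        pochhammer (- of_nat s) (k + m) * t ^ (s - k) * w ^ (\<upsilon> * m) /
        (Gamma (p - 2 * of_nat s + of_nat k) * Gamma (q + 1 + of_nat (\<upsilon> * m)) * fact k * fact m))"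

definition RL_integrand :: "real \<Rightarrow> complex \<Rightarrow> (real \<Rightarrow> complex) \<Rightarrow> real \<Rightarrow> complex" where
  "RL_integrand w \<kappa> f \<xi> = complex_of_real (w - \<xi>) powr (\<kappa> - 1) * f \<xi>"

text \<open>The Lebesgue integral is taken over the open interval because the integrand
  may be singular at both endpoints.\<close>

definition RL_exists :: "real \<Rightarrow> complex \<Rightarrow> (real \<Rightarrow> complex) \<Rightarrow> real \<Rightarrow> bool" where
  "RL_exists b \<kappa> f w \<longleftrightarrow> set_integrable lborel {b<..<w} (RL_integrand w \<kappa> f)"

definition RL_integral :: "real \<Rightarrow> complex \<Rightarrow> (real \<Rightarrow> complex) \<Rightarrow> real \<Rightarrow> complex" where
  "RL_integral b \<kappa> f w = 1 / Gamma \<kappa> * (LBINT \<xi>:{b<..<w}. RL_integrand w \<kappa> f \<xi>)"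

end

theory Submission
  imports Defs
begin

text \<open>
  Multiplied by \<open>(x - b)\<^sup>q\<close>, the polynomial becomes a finite linear combination of powers
  \<open>(x - b)\<^bsup>a - 1\<^esup>\<close> with \<open>a = q + 1 + \<upsilon> m > 0\<close>, in which each term carries the factor
  \<open>1 / \<Gamma>(a)\<close>. The fractional integral of order \<open>\<tau>\<close> sends \<open>(x - b)\<^bsup>a - 1\<^esup> / \<Gamma>(a)\<close> to
  \<open>(w - b)\<^bsup>a + \<tau> - 1\<^esup> / \<Gamma>(a + \<tau>)\<close>, so its whole effect on the sum is to replace \<open>q\<close> by
  \<open>q + \<tau>\<close>: once in the exponent in front, and once in the factor \<open>\<Gamma>(q + 1 + \<upsilon> m)\<close> of
  each denominator. The parameter \<open>q\<close> occurs nowhere else.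

  This power rule (\<open>has_bochner_integral_RL_power\<close>) is Euler's Beta integral after an affine
  substitution, but with the complex parameter \<open>\<tau>\<close>. The Beta integral
  (\<open>integral_truncated_power_beta_unit\<close>) is obtained by the classical convolution argument: the
  functions \<open>g\<^sub>z(t) = t\<^bsup>z - 1\<^esup> e\<^bsup>-t\<^esup>\<close> on \<open>t > 0\<close> have integral \<open>\<Gamma>(z)\<close>, so the
  convolution of \<open>g\<^sub>a\<close> and \<open>g\<^sub>c\<close> has integral \<open>\<Gamma>(a) \<Gamma>(c)\<close> by Fubini's theorem; by
  homogeneity that convolution is also \<open>g\<^bsub>a+c\<^esub>\<close> times the Beta integral.
\<close>

section \<open>Truncated powers\<close>

text \<open>
  Extending powers by 0 to the negative axis makes integrals over \<open>{b<..<w}\<close> integrals over the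
  whole line: in a product \<open>truncated_power _ (w - x) * truncated_power _ (x - b)\<close> the two
  factors cut off the two ends. Translations, scalings and Fubini's theorem then need no
  bookkeeping of domains, and joint measurability comes by composition.
\<close>

definition truncated_power :: "complex \<Rightarrow> real \<Rightarrow> complex" where
  "truncated_power z x = indicator {0<..} x *\<^sub>R complex_of_real x powr z"

lemma borel_measurable_truncated_power [measurable]:
  "truncated_power z \<in> borel_measurable borel"
  unfolding truncated_power_def
  by (rule borel_measurable_continuous_on_indicator) (auto intro!: continuous_intros)

lemma norm_truncated_power:
  "norm (truncated_power z x) = indicator {0<..} x * x powr Re z"
  by (auto simp: truncated_power_def indicator_def norm_powr_real_powr)

lemma truncated_power_scale:
  assumes "r > 0"
  shows "truncated_power z (r * x) = complex_of_real r powr z * truncated_power z x"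
  using assms
  by (auto simp: truncated_power_def indicator_def zero_less_mult_iff powr_times_real)

text \<open>
  The map \<open>x \<mapsto> b + (w - b) x\<close> carries the unit interval to the interval from \<open>b\<close> to \<open>w\<close>; by
  homogeneity the integrand changes by a constant factor only.
\<close>

lemma truncated_power_beta_affine:
  assumes "b < w"
  shows "truncated_power (c - 1) (w - (b + (w - b) * x)) *
           truncated_power (a - 1) ((b + (w - b) * x) - b) =
         complex_of_real (w - b) powr (a + c - 2) *
           (truncated_power (c - 1) (1 - x) * truncated_power (a - 1) x)"
proof -
  have "w - (b + (w - b) * x) = (w - b) * (1 - x)"
    by (simp add: algebra_simps)
  moreover have "complex_of_real (w - b) powr (a + c - 2) =
      complex_of_real (w - b) powr (c - 1) * complex_of_real (w - b) powr (a - 1)"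
    by (simp add: powr_add [symmetric] algebra_simps)
  ultimately show ?thesis
    using assms by (simp add: truncated_power_scale del: of_real_diff)
qed

text \<open>
  The exponent exceeds that of \<open>truncated_power_beta_affine\<close> by 1, the contribution of the Jacobian.
\<close>

lemma integral_truncated_power_beta:
  assumes "b < w"
  shows "(\<integral>x. truncated_power (c - 1) (w - x) * truncated_power (a - 1) (x - b) \<partial>lborel) =
    complex_of_real (w - b) powr (a + c - 1) *
      (\<integral>x. truncated_power (c - 1) (1 - x) * truncated_power (a - 1) x \<partial>lborel)"
proof -
  have "complex_of_real (w - b) powr (a + c - 1) = 
      complex_of_real (w - b) powr (a + c - 2) * complex_of_real (w - b) powr 1"
    by (subst powr_add [symmetric]) (simp add: algebra_simps)
  then have *: "complex_of_real (w - b) powr (a + c - 1) = 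
      complex_of_real (w - b) * complex_of_real (w - b) powr (a + c - 2)"
    using assms by (simp add: mult.commute del: of_real_diff)
  show ?thesis
    using assms unfolding *
    by (subst lborel_integral_real_affine [where c = "w - b" and t = b])
       (simp_all only: truncated_power_beta_affine, 
        simp_all add: scaleR_conv_of_real del: of_real_diff)
qed

text \<open>
  In absolute value the integrand is the real Beta integrand with parameters \<open>Re a\<close> and \<open>Re c\<close>.
\<close>

lemma integrable_truncated_power_beta_unit:
  assumes "Re a > 0" "Re c > 0"
  shows "integrable lborel (\<lambda>x. truncated_power (c - 1) (1 - x) * truncated_power (a - 1) x)"
proof (rule Bochner_Integration.integrable_bound [OF _ _ AE_I2])
  show "integrable lborel
      (\<lambda>x. indicator {0..1} x *\<^sub>R (x powr (Re a - 1) * (1 - x) powr (Re c - 1)))"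
    using integrable_Beta [OF assms] unfolding set_integrable_def .
qed (auto simp: norm_mult norm_truncated_power indicator_def)

lemma integrable_truncated_power_beta:
  assumes "Re a > 0" "Re c > 0" "b < w"
  shows "integrable lborel
    (\<lambda>x. truncated_power (c - 1) (w - x) * truncated_power (a - 1) (x - b))"
proof -
  have "integrable lborel (\<lambda>x. truncated_power (c - 1) (w - (b + (w - b) * x)) *
           truncated_power (a - 1) ((b + (w - b) * x) - b))"
    unfolding truncated_power_beta_affine [OF assms(3)]
    by (intro integrable_mult_right integrable_truncated_power_beta_unit assms)
  then show ?thesis
    using assms
    by (subst (asm) lborel_integrable_real_affine_iff
          [where f = "\<lambda>x. truncated_power (c - 1) (w - x) * truncated_power (a - 1) (x - b)"])
       simp_all
qed

section \<open>The Beta integral with complex parameters\<close>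

lemma Gamma_nonzero_if_Re_pos:
  assumes "Re z > 0"
  shows "Gamma z \<noteq> 0"
proof
  assume "Gamma z = 0"
  then obtain n where "z = - of_nat n"
    by (auto simp: Gamma_eq_zero_iff elim: nonpos_Ints_cases')
  then have "Re z = - real n"
    by simp
  with assms show False
    by simp
qed

lemma has_bochner_integral_Gamma_complex:
  assumes "Re z > 0"
  shows "has_bochner_integral lborel (\<lambda>t. truncated_power (z - 1) t * of_real (exp (- t))) (Gamma z)"
proof -
  have eq: "truncated_power (z - 1) t * of_real (exp (- t)) =
      indicator {0<..} t *\<^sub>R (of_real t powr (z - 1) / of_real (exp t))" for t
    by (simp add: truncated_power_def exp_minus field_simps)
  have "(\<lambda>t. truncated_power (z - 1) t * of_real (exp (- t))) \<in> borel_measurable lborel"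
    by measurable
  moreover have "integrable lebesgue (\<lambda>t. truncated_power (z - 1) t * of_real (exp (- t)))"
    using absolutely_integrable_Gamma_integral' [OF assms]
    unfolding eq set_integrable_def .
  ultimately have int: "integrable lborel (\<lambda>t. truncated_power (z - 1) t * of_real (exp (- t)))"
    by (simp add: integrable_completion)
  then have "(LBINT t:{0<..}. of_real t powr (z - 1) / of_real (exp t)) =
      integral {0<..} (\<lambda>t. complex_of_real t powr (z - 1) / of_real (exp t))"
    by (intro set_borel_integral_eq_integral(2)) (simp add: set_integrable_def eq)
  then have "(\<integral>t. truncated_power (z - 1) t * of_real (exp (- t)) \<partial>lborel) = Gamma z"
    using Gamma_integral_complex' [OF assms]
    by (simp only: eq set_lebesgue_integral_def integral_unique)
  with int show ?thesis
    by (simp add: has_bochner_integral_iff)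
qed

text \<open>
  The integral of the convolution of two Gamma densities is computed twice: by exchanging the
  order of integration it is \<open>\<Gamma>(a) \<Gamma>(c)\<close>, and by scaling the inner integral to the unit
  interval it is \<open>\<Gamma>(a + c)\<close> times the integral sought.
\<close>

theorem integral_truncated_power_beta_unit:
  assumes a: "Re a > 0" and c: "Re c > 0"
  shows "(\<integral>x. truncated_power (c - 1) (1 - x) * truncated_power (a - 1) x \<partial>lborel) = Beta a c"
    (is "?J = _")
proof -
  define g where "g = (\<lambda>z t. truncated_power (z - 1) t * complex_of_real (exp (- t)))"
  have [measurable]: "g z \<in> borel_measurable borel" for z
    unfolding g_def by measurable
  have g: "has_bochner_integral lborel (g z) (Gamma z)" if "Re z > 0" for z
    using has_bochner_integral_Gamma_complex [OF that] by (simp add: g_def)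
  have shift: "has_bochner_integral lborel (\<lambda>u. f (u - t)) I"
    if "has_bochner_integral lborel f I" for f :: "real \<Rightarrow> 'b::{banach, second_countable_topology}" and I t
    using that lborel_has_bochner_integral_real_affine_iff [of 1 f I "-t"]
    by (simp add: algebra_simps)
  have inner: "has_bochner_integral lborel (\<lambda>u. g a t * g c (u - t)) (g a t * Gamma c)" for t
    by (intro has_bochner_integral_mult_right shift g c)
  have "integrable (lborel \<Otimes>\<^sub>M lborel) (\<lambda>(t, u). g a t * g c (u - t))"
  proof (rule lborel_pair.Fubini_integrable)
    have "has_bochner_integral lborel (\<lambda>u. norm (g c (u - t))) (\<integral>u. norm (g c u) \<partial>lborel)" for t
      by (intro shift has_bochner_integral_integrable integrable_norm)
         (use g [OF c] in \<open>simp add: has_bochner_integral_iff\<close>)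
    then have "(\<integral>u. norm (g a t * g c (u - t)) \<partial>lborel) =
        norm (g a t) * (\<integral>u. norm (g c u) \<partial>lborel)" for t
      by (simp add: norm_mult has_bochner_integral_iff)
    moreover have "integrable lborel (\<lambda>t. norm (g a t) * (\<integral>u. norm (g c u) \<partial>lborel))"
      using g [OF a] by (simp add: has_bochner_integral_iff)
    ultimately show "integrable lborel (\<lambda>t. \<integral>u. norm (case (t, u) of (t, u) \<Rightarrow> g a t * g c (u - t)) \<partial>lborel)"
      by simp
  qed (use inner in \<open>auto simp: has_bochner_integral_iff\<close>)
  then have "(\<integral>u. (\<integral>t. g a t * g c (u - t) \<partial>lborel) \<partial>lborel) =
      (\<integral>t. (\<integral>u. g a t * g c (u - t) \<partial>lborel) \<partial>lborel)"
    by (rule lborel_pair.Fubini_integral)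
  also have "\<dots> = Gamma a * Gamma c"
    unfolding has_bochner_integral_integral_eq [OF inner]
    using g [OF a] by (simp add: has_bochner_integral_iff)
  also have "(\<lambda>u. \<integral>t. g a t * g c (u - t) \<partial>lborel) = (\<lambda>u. g (a + c) u * ?J)"
  proof
    fix u :: real
    have weights: "complex_of_real (exp (- t)) * complex_of_real (exp (- (u - t))) =
        complex_of_real (exp (- u))" for t
      by (simp add: exp_add [symmetric] flip: of_real_mult)
    \<comment> \<open>The exponential weights combine to a factor that does not depend on \<open>t\<close>.
      Writing \<open>t - 0\<close> brings the rest into the form of the scaling lemma with \<open>b = 0\<close>.\<close>
    have "g a t * g c (u - t) = complex_of_real (exp (- u)) *
        (truncated_power (c - 1) (u - t) * truncated_power (a - 1) (t - 0))" for t
      unfolding g_def weights [of t, symmetric] by (simp only: diff_0_right mult_ac)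
    then have conv: "(\<integral>t. g a t * g c (u - t) \<partial>lborel) = complex_of_real (exp (- u)) *
        (\<integral>t. truncated_power (c - 1) (u - t) * truncated_power (a - 1) (t - 0) \<partial>lborel)"
      by simp
    show "(\<integral>t. g a t * g c (u - t) \<partial>lborel) = g (a + c) u * ?J"
    proof (cases "u > 0")
      case True
      then show ?thesis
        unfolding conv integral_truncated_power_beta [OF True]
        by (simp add: g_def truncated_power_def mult_ac)
    next
      case False
      then have zero: "truncated_power (c - 1) (u - t) * truncated_power (a - 1) (t - 0) = 0" for t
        by (auto simp: truncated_power_def indicator_def)
      with False show ?thesis
        unfolding conv zero by (simp add: g_def truncated_power_def)
    qed
  qed
  also have "(\<integral>u. g (a + c) u * ?J \<partial>lborel) = Gamma (a + c) * ?J"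
    using g [of "a + c"] a c by (simp add: has_bochner_integral_iff)
  finally have "Gamma (a + c) * ?J = Gamma a * Gamma c" .
  moreover have "Gamma (a + c) \<noteq> 0"
    using a c by (intro Gamma_nonzero_if_Re_pos) simp
  ultimately show ?thesis
    by (simp add: Beta_def field_simps)
qed

section \<open>Fractional integrals\<close>

text \<open>
  The power rule, before division by \<open>\<Gamma>(\<tau>)\<close>. Stating it with \<open>has_bochner_integral\<close> carries
  existence and value together, so that finite linear combinations settle both at once.
\<close>

lemma has_bochner_integral_RL_power:
  assumes "Re a > 0" "Re \<tau> > 0" "b < w"
  shows "has_bochner_integral lborel
    (\<lambda>x. indicator {b<..<w} x *\<^sub>R RL_integrand w \<tau> (\<lambda>x. complex_of_real (x - b) powr (a - 1)) x)
    (complex_of_real (w - b) powr (a + \<tau> - 1) * Beta a \<tau>)"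
proof -
  have "indicator {b<..<w} x *\<^sub>R RL_integrand w \<tau> (\<lambda>x. complex_of_real (x - b) powr (a - 1)) x =
      truncated_power (\<tau> - 1) (w - x) * truncated_power (a - 1) (x - b)" for x
    by (auto simp: RL_integrand_def truncated_power_def indicator_def)
  then show ?thesis
    using integrable_truncated_power_beta [OF assms]
    by (simp add: has_bochner_integral_iff integral_truncated_power_beta [OF assms(3)]
        integral_truncated_power_beta_unit [OF assms(1,2)])
qed

theorem theorem34:
  fixes \<upsilon> s :: nat and p q t y w b :: real and \<tau> :: complex
  assumes "\<upsilon> \<ge> 1" and "q > -1" and "real s < (p - 1) / 2" and "w > b" and "Re \<tau> > 0"
  defines "f \<equiv> \<lambda>x::real. complex_of_real ((x - b) powr q) *
      konhauser_N s \<upsilon> (complex_of_real p) (complex_of_real q)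
        (complex_of_real t) (complex_of_real ((x - b) * y))"
  shows "RL_exists b \<tau> f w \<and>
    RL_integral b \<tau> f w =
      complex_of_real (w - b) powr (complex_of_real q + \<tau>) *
      konhauser_N s \<upsilon> (complex_of_real p) (complex_of_real q + \<tau>)
        (complex_of_real t) (complex_of_real ((w - b) * y))"
proof -
  define a where "a = (\<lambda>m. complex_of_real q + 1 + of_nat (\<upsilon> * m))"
  define C where "C = (\<lambda>k m. Gamma (complex_of_real p - of_nat s) *
      (pochhammer (- of_nat s) (k + m) * complex_of_real t ^ (s - k) * complex_of_real y ^ (\<upsilon> * m) /
        (Gamma (complex_of_real p - 2 * of_nat s + of_nat k) * fact k * fact m)))"
  have wb: "w - b > 0"
    using assms(4) by simp
  have Re_a: "Re (a m) > 0" for m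
    using assms(2) by (simp add: a_def add_pos_nonneg)
  have powr_a: "complex_of_real r powr (z + of_nat n) = complex_of_real r powr z * complex_of_real r ^ n"
    if "r > 0" for r z n
    using that by (simp add: powr_add)
  \<comment> \<open>Stated for a shift \<open>\<sigma>\<close> of the second parameter, this expansion covers both sides of the
    claim: \<open>\<sigma> = 0\<close> gives \<open>f\<close>, and \<open>\<sigma> = \<tau>\<close> the right-hand side.
    The coefficients \<open>C k m\<close> are independent of \<open>\<sigma>\<close>.\<close>
  have N: "complex_of_real r powr (q + \<sigma>) * konhauser_N s \<upsilon> p (q + \<sigma>) t (complex_of_real (r * y)) =
      (\<Sum>k=0..s. \<Sum>m=0..s-k. C k m / Gamma (a m + \<sigma>) * complex_of_real r powr (a m + \<sigma> - 1))"
    if "r > 0" for r :: real and \<sigma> :: complex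
  proof -
    have "complex_of_real r powr (a m + \<sigma> - 1) =
        complex_of_real r powr (q + \<sigma>) * complex_of_real r ^ (\<upsilon> * m)" for m
      using powr_a [OF that, of "q + \<sigma>" "\<upsilon> * m"] by (simp add: a_def algebra_simps)
    then show ?thesis
      unfolding konhauser_N_def sum_distrib_left
      by (intro sum.cong refl) (simp add: C_def a_def power_mult_distrib algebra_simps)
  qed
  have f: "f x = (\<Sum>k=0..s. \<Sum>m=0..s-k. C k m / Gamma (a m) * complex_of_real (x - b) powr (a m - 1))"
    if "x > b" for x
    using N [of "x - b" 0] that by (simp add: f_def powr_of_real del: of_real_diff)
  have "has_bochner_integral lborel
      (\<lambda>x. \<Sum>k=0..s. \<Sum>m=0..s-k. C k m / Gamma (a m) * (indicator {b<..<w} x *\<^sub>R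
        RL_integrand w \<tau> (\<lambda>x. complex_of_real (x - b) powr (a m - 1)) x))
      (\<Sum>k=0..s. \<Sum>m=0..s-k. C k m / Gamma (a m) *
        (complex_of_real (w - b) powr (a m + \<tau> - 1) * Beta (a m) \<tau>))"
    by (intro has_bochner_integral_sum has_bochner_integral_mult_right
        has_bochner_integral_RL_power Re_a assms)
  also have "(\<lambda>x. \<Sum>k=0..s. \<Sum>m=0..s-k. C k m / Gamma (a m) * (indicator {b<..<w} x *\<^sub>R
        RL_integrand w \<tau> (\<lambda>x. complex_of_real (x - b) powr (a m - 1)) x)) =
      (\<lambda>x. indicator {b<..<w} x *\<^sub>R RL_integrand w \<tau> f x)"
    by (auto simp: fun_eq_iff indicator_def RL_integrand_def f sum_distrib_left mult_ac
        simp del: of_real_diff intro!: sum.cong)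
  also have "(\<Sum>k=0..s. \<Sum>m=0..s-k. C k m / Gamma (a m) *
        (complex_of_real (w - b) powr (a m + \<tau> - 1) * Beta (a m) \<tau>)) =
      Gamma \<tau> * (complex_of_real (w - b) powr (q + \<tau>) *
        konhauser_N s \<upsilon> p (q + \<tau>) t (complex_of_real ((w - b) * y)))"
  proof -
    \<comment> \<open>The factor \<open>\<Gamma>(a m)\<close> of the Beta value cancels the one in the denominator.\<close>
    have "Gamma (a m) \<noteq> 0" for m
      using Re_a by (rule Gamma_nonzero_if_Re_pos)
    then show ?thesis
      unfolding N [OF wb]
      by (simp add: sum_distrib_left Beta_def mult_ac del: of_real_diff of_real_mult)
  qed
  finally have *: "has_bochner_integral lborel (\<lambda>x. indicator {b<..<w} x *\<^sub>R RL_integrand w \<tau> f x)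
      (Gamma \<tau> * (complex_of_real (w - b) powr (q + \<tau>) *
        konhauser_N s \<upsilon> p (q + \<tau>) t (complex_of_real ((w - b) * y))))" .
  moreover have "Gamma \<tau> \<noteq> 0"
    using assms(5) by (rule Gamma_nonzero_if_Re_pos)
  ultimately show ?thesis
    unfolding RL_exists_def RL_integral_def set_integrable_def set_lebesgue_integral_def
    by (simp add: has_bochner_integral_iff del: of_real_diff of_real_mult)
qed

end
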